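(* Let $A\subseteq B$ be a ring extension, and let $\mathcal{G}_1\subseteq\mathcal{G}_2$ be two upward closed subsets of $\mathbf{F}_A(B)$. Then the following hold. (a) For every $\star\in\mathrm{Mult}(A,B,\mathcal{G}_1)$, the map $\widehat{\star}:\mathcal{G}_2\to\mathcal{G}_2$ defined by $$I\longmapsto\bigcap_{\substack{J\in\mathcal{G}_1\\ J=J^\star}}(J:_B(J:_BI))$$ is a multiplicative operation on $(A,B,\mathcal{G}_2)$. (b) The map $\eta:\mathrm{Mult}(A,B,\mathcal{G}_1)\to\mathrm{Mult}(A,B,\mathcal{G}_2)$, $\star\mapsto\widehat{\star}$, is well-defined and order-preserving. (c) If $\rho:\mathrm{Mult}(A,B,\mathcal{G}_2)\to\mathrm{Mult}(A,B,\mathcal{G}_1)$ is the restriction map $\star\mapsto\star|_{\mathcal{G}_1}$, then $\rho\circ\eta$ is the identity on $\mathrm{Mult}(A,B,\mathcal{G}_1)$, i.e., $\widehat{\star}|_{\mathcal{G}_1}=\star$. In particular, $\eta$ is injective and $\rho$ is surjective.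
   Context: All rings are commutative with unit. For a ring extension $A\subseteq B$, $\mathbf{F}_A(B)$ is the set of $A$-submodules of $B$, ordered by inclusion; for $I,J\in\mathbf{F}_A(B)$ and $b\in B$, $(I:b):=\{x\in B\mid bx\in I\}$ and $(I:_BJ):=\{x\in B\mid xJ\subseteq I\}$. A closure operation on a partially ordered set is an extensive, order-preserving, idempotent self-map. For $\mathcal{G}\subseteq\mathbf{F}_A(B)$, a multiplicative operation on $(A,B,\mathcal{G})$ is a closure operation $\star:\mathcal{G}\to\mathcal{G}$, $I\mapsto I^\star$, such that $(I:b)^\star\subseteq(I^\star:b)$ for all $I\in\mathcal{G}$, $b\in B$ with $(I:b)\in\mathcal{G}$. $\mathrm{Mult}(A,B,\mathcal{G})$ is the set of these, ordered by $\star_1\leq\star_2$ iff $I^{\star_1}\subseteq I^{\star_2}$ for all $I\in\mathcal{G}$. $\mathcal{G}$ is upward closed if $X\in\mathcal{G}$, $Y\in\mathbf{F}_A(B)$ and $X\subseteq Y$ imply $Y\in\mathcal{G}$. The restriction map $\rho$ is well-defined in this setting (every multiplicative operation on $(A,B,\mathcal{G}_2)$ maps $\mathcal{G}_1$ into itself and restricts to a multiplicative operation on $(A,B,\mathcal{G}_1)$). *)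

theory Defs
  imports "HOL-Algebra.Module" "HOL-Algebra.Subrings" "HOL-Library.FuncSet"
begin

text \<open>
  A ring extension is a commutative ring \<open>B\<close> together with a subring \<open>A\<close> given as a
  subset of \<open>carrier B\<close>.  The zero ring is allowed.
\<close>

definition ring_extension :: "'a set \<Rightarrow> ('a, 'm) ring_scheme \<Rightarrow> bool" where
  "ring_extension A B \<longleftrightarrow> cring B \<and> subring A B"

definition regular_module :: "('a, 'm) ring_scheme \<Rightarrow> ('a, 'a) module" where
  "regular_module B =
     \<lparr>carrier = carrier B, monoid.mult = monoid.mult B, one = one B,
      zero = zero B, add = add B, smult = monoid.mult B\<rparr>"

lemma regular_module_is_module:
  assumes "ring_extension A B"
  shows "module (B\<lparr>carrier := A\<rparr>) (regular_module B)"
proof -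
  interpret cring B using assms by (simp add: ring_extension_def)
  have A: "subring A B" using assms by (simp add: ring_extension_def)
  have sub: "A \<subseteq> carrier B" using A subringE(1) by blast
  have "subcring A B" using A subcringI' by blast
  then have "cring (B\<lparr>carrier := A\<rparr>)"
    using subcring_iff[OF sub] by simp
  moreover have "abelian_group (regular_module B)"
    by (rule abelian_groupI)
      (auto simp: regular_module_def a_ac intro: l_neg a_inv_closed)
  ultimately show ?thesis
    using sub
    by (intro moduleI) (auto simp: regular_module_def l_distr r_distr m_assoc subset_iff)
qed

definition submods :: "'a set \<Rightarrow> ('a, 'm) ring_scheme \<Rightarrow> 'a set set" where
  "submods A B = {I. submodule I (B\<lparr>carrier := A\<rparr>) (regular_module B)}"

definition upward_closed :: "'a set \<Rightarrow> ('a, 'm) ring_scheme \<Rightarrow> 'a set set \<Rightarrow> bool" where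
  "upward_closed A B G \<longleftrightarrow>
     G \<subseteq> submods A B \<and> (\<forall>X\<in>G. \<forall>Y\<in>submods A B. X \<subseteq> Y \<longrightarrow> Y \<in> G)"

text \<open>\<open>elem_colon B I b\<close> is $(I : b)$ and \<open>colon B I J\<close> is $(I :_B J)$.\<close>

definition elem_colon :: "('a, 'm) ring_scheme \<Rightarrow> 'a set \<Rightarrow> 'a \<Rightarrow> 'a set" where
  "elem_colon B I b = {x \<in> carrier B. b \<otimes>\<^bsub>B\<^esub> x \<in> I}"

definition colon :: "('a, 'm) ring_scheme \<Rightarrow> 'a set \<Rightarrow> 'a set \<Rightarrow> 'a set" where
  "colon B I J = {x \<in> carrier B. x <#\<^bsub>B\<^esub> J \<subseteq> I}"

definition closure_operation_on :: "'a::order set \<Rightarrow> ('a \<Rightarrow> 'a) \<Rightarrow> bool" where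
  "closure_operation_on P c \<longleftrightarrow>
     c \<in> P \<rightarrow> P \<and> (\<forall>x\<in>P. x \<le> c x) \<and> mono_on P c \<and> (\<forall>x\<in>P. c (c x) = c x)"

text \<open>
  Self-maps of \<open>G\<close> are represented by extensional functions (\<open>undefined\<close> outside \<open>G\<close>), so
  that HOL equality of elements of \<open>Mult A B G\<close> is equality of maps on \<open>G\<close>.
\<close>

definition Mult ::
    "'a set \<Rightarrow> ('a, 'm) ring_scheme \<Rightarrow> 'a set set \<Rightarrow> ('a set \<Rightarrow> 'a set) set" where
  "Mult A B G = {star \<in> extensional G.
     closure_operation_on G star \<and>
     (\<forall>I\<in>G. \<forall>b\<in>carrier B. elem_colon B I b \<in> G \<longrightarrow>
        star (elem_colon B I b) \<subseteq> elem_colon B (star I) b)}"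

definition mult_le :: "'a set set \<Rightarrow> ('a set \<Rightarrow> 'a set) \<Rightarrow> ('a set \<Rightarrow> 'a set) \<Rightarrow> bool" where
  "mult_le G star1 star2 \<longleftrightarrow> (\<forall>I\<in>G. star1 I \<subseteq> star2 I)"

text \<open>
  The intersection is formed inside \<open>carrier B\<close>: if \<open>G1\<close> is empty, the empty intersection
  is \<open>B\<close>.
\<close>

definition hat_op ::
    "('a, 'm) ring_scheme \<Rightarrow> 'a set set \<Rightarrow> 'a set set \<Rightarrow> ('a set \<Rightarrow> 'a set) \<Rightarrow> 'a set \<Rightarrow> 'a set" where
  "hat_op B G1 G2 star =
     (\<lambda>I\<in>G2. carrier B \<inter> (\<Inter>J\<in>{J \<in> G1. J = star J}. colon B J (colon B J I)))"

definition restr_op :: "'a set set \<Rightarrow> ('a set \<Rightarrow> 'a set) \<Rightarrow> 'a set \<Rightarrow> 'a set" where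
  "restr_op G1 star = restrict star G1"

end

theory Submission
  imports Defs
begin

text \<open>
  Write \<open>c\<^sub>J(I) = (J : (J : I))\<close>.  For a fixed \<open>J\<close> the map \<open>X \<mapsto> (J : X)\<close> is an antitone Galois
  connection of the subsets of \<open>B\<close> with themselves, because multiplication is commutative: both
  \<open>X \<subseteq> (J : Y)\<close> and \<open>Y \<subseteq> (J : X)\<close> say that all products \<open>x y\<close> lie in \<open>J\<close>.  Hence every \<open>c\<^sub>J\<close> is
  a closure operation, and so is an intersection of such operations.  Its values are submodules
  that contain the argument, so they stay in \<open>G2\<close>.  It is multiplicative because
  \<open>y \<in> (J : I)\<close> implies \<open>y b \<in> (J : (I : b))\<close> (\<open>colon_colon_multiplicative\<close>).  This gives (a),
  in \<open>hat_op_in_Mult\<close>.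

  If \<open>\<star>\<^sub>1 \<le> \<star>\<^sub>2\<close>, every \<open>\<star>\<^sub>2\<close>-closed submodule is \<open>\<star>\<^sub>1\<close>-closed, so the intersection for
  \<open>\<star>\<^sub>2\<close> has fewer factors and is larger; this is (b).

  For (c), let \<open>I \<in> G1\<close>.  Since \<open>1 \<in> (I\<^sup>\<star> : I)\<close>, the factor of the intersection at
  \<open>J = I\<^sup>\<star>\<close> is contained in \<open>I\<^sup>\<star>\<close>.  Conversely, if \<open>J\<close> is closed and \<open>y \<in> (J : I)\<close>, then
  \<open>I \<subseteq> (J : y)\<close>.  So \<open>(J : y)\<close> is in \<open>G1\<close>, and multiplicativity makes it closed, whence
  \<open>I\<^sup>\<star> \<subseteq> (J : y)\<close> (\<open>closed_elem_colon\<close>).  As \<open>y\<close> was arbitrary, \<open>I\<^sup>\<star> \<subseteq> c\<^sub>J(I)\<close>.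
  Injectivity and surjectivity are then formal, once restriction is known to land in the
  operations on \<open>G1\<close> (\<open>restr_op_in_Mult\<close>).
\<close>

lemma submods_iff:
  "I \<in> submods A B \<longleftrightarrow>
     subgroup I (add_monoid B) \<and> (\<forall>a\<in>A. \<forall>x\<in>I. a \<otimes>\<^bsub>B\<^esub> x \<in> I)"
  by (auto simp: submods_def submodule_def submodule_axioms_def regular_module_def
      subgroup_def a_inv_def m_inv_def)

lemma submods_subset: "I \<in> submods A B \<Longrightarrow> I \<subseteq> carrier B"
  by (auto simp: submods_iff subgroup_def)

lemma mem_colon_iff:
  "x \<in> colon B J I \<longleftrightarrow> x \<in> carrier B \<and> (\<forall>y\<in>I. x \<otimes>\<^bsub>B\<^esub> y \<in> J)"
  by (auto simp: colon_def l_coset_def)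

text \<open>
  This reduces the submodule property of \<open>(J : X)\<close> to that of a preimage of \<open>J\<close> under one
  multiplication map.
\<close>

lemma colon_eq_INT_elem_colon:
  assumes "ring_extension A B" and "I \<subseteq> carrier B"
  shows "colon B J I = carrier B \<inter> (\<Inter>y\<in>I. elem_colon B J y)"
proof -
  interpret cring B using assms by (simp add: ring_extension_def)
  show ?thesis
    using assms(2) by (fastforce simp: mem_colon_iff elem_colon_def m_comm subset_iff)
qed

lemma carrier_in_submods:
  assumes "ring_extension A B"
  shows "carrier B \<in> submods A B"
proof -
  interpret cring B using assms by (simp add: ring_extension_def)
  have "A \<subseteq> carrier B"
    using assms subringE(1) by (auto simp: ring_extension_def)
  then show ?thesis
    using add.subgroup_self by (auto simp: submods_iff)
qed

lemma carrier_Int_INT_in_submods: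
  assumes "ring_extension A B" and "\<And>i. i \<in> S \<Longrightarrow> F i \<in> submods A B"
  shows "carrier B \<inter> (\<Inter>i\<in>S. F i) \<in> submods A B"
  using carrier_in_submods[OF assms(1)] assms(2)
  by (auto simp: submods_iff subgroup_def)

lemma elem_colon_in_submods:
  assumes "ring_extension A B" and "J \<in> submods A B" and "b \<in> carrier B"
  shows "elem_colon B J b \<in> submods A B"
proof -
  interpret cring B using assms by (simp add: ring_extension_def)
  have A: "A \<subseteq> carrier B"
    using assms(1) subringE(1) by (auto simp: ring_extension_def)
  have J: "subgroup J (add_monoid B)" "\<And>a x. a \<in> A \<Longrightarrow> x \<in> J \<Longrightarrow> a \<otimes>\<^bsub>B\<^esub> x \<in> J"
    using assms(2) by (auto simp: submods_iff)
  have "subgroup (elem_colon B J b) (add_monoid B)"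
  proof (rule add.subgroupI)
    show "elem_colon B J b \<noteq> {}"
      using J(1) assms(3) subgroup.one_closed[OF J(1)] by (auto simp: elem_colon_def
          intro!: exI[of _ "\<zero>\<^bsub>B\<^esub>"])
  next
    fix x assume "x \<in> elem_colon B J b"
    then show "\<ominus>\<^bsub>B\<^esub> x \<in> elem_colon B J b"
      using subgroup.m_inv_closed[OF J(1)] assms(3)
      by (auto simp: elem_colon_def r_minus a_inv_def[symmetric])
  next
    fix x y assume "x \<in> elem_colon B J b" "y \<in> elem_colon B J b"
    then show "x \<oplus>\<^bsub>B\<^esub> y \<in> elem_colon B J b"
      using subgroup.m_closed[OF J(1)] assms(3)
      by (auto simp: elem_colon_def r_distr)
  qed (auto simp: elem_colon_def)
  moreover have "a \<otimes>\<^bsub>B\<^esub> x \<in> elem_colon B J b" if "a \<in> A" "x \<in> elem_colon B J b" for a x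
    using that A J(2)[of a "b \<otimes>\<^bsub>B\<^esub> x"] assms(3)
    by (auto simp: elem_colon_def m_lcomm subset_iff)
  ultimately show ?thesis by (auto simp: submods_iff)
qed

lemma colon_in_submods:
  assumes "ring_extension A B" and "J \<in> submods A B" and "X \<subseteq> carrier B"
  shows "colon B J X \<in> submods A B"
  unfolding colon_eq_INT_elem_colon[OF assms(1,3)]
  using assms by (intro carrier_Int_INT_in_submods elem_colon_in_submods) auto

lemma colon_antimono: "X \<subseteq> Y \<Longrightarrow> colon B J Y \<subseteq> colon B J X"
  unfolding colon_def l_coset_def by blast

lemma colon_subset_carrier: "colon B J X \<subseteq> carrier B"
  by (auto simp: mem_colon_iff)

lemma subset_colon_colon:
  assumes "ring_extension A B" and "X \<subseteq> carrier B"
  shows "X \<subseteq> colon B J (colon B J X)"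
proof -
  interpret cring B using assms by (simp add: ring_extension_def)
  show ?thesis using assms(2) by (fastforce simp: mem_colon_iff m_comm subset_iff)
qed

text \<open>
  If \<open>y I \<subseteq> J\<close> then \<open>y b (I : b) \<subseteq> y I \<subseteq> J\<close>, so \<open>x \<in> (J : (J : (I : b)))\<close> multiplies \<open>y b\<close>
  into \<open>J\<close>, that is, \<open>b x\<close> multiplies \<open>y\<close> into \<open>J\<close>.
\<close>

lemma colon_colon_multiplicative:
  assumes "ring_extension A B" and "b \<in> carrier B"
  shows "colon B J (colon B J (elem_colon B I b)) \<subseteq> elem_colon B (colon B J (colon B J I)) b"
proof
  interpret cring B using assms by (simp add: ring_extension_def)
  fix x assume x: "x \<in> colon B J (colon B J (elem_colon B I b))"
  then have xB: "x \<in> carrier B" by (simp add: mem_colon_iff)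
  have "(b \<otimes>\<^bsub>B\<^esub> x) \<otimes>\<^bsub>B\<^esub> y \<in> J" if y: "y \<in> colon B J I" for y
  proof -
    have yB: "y \<in> carrier B" using y by (simp add: mem_colon_iff)
    have "y \<otimes>\<^bsub>B\<^esub> b \<in> colon B J (elem_colon B I b)"
      using y assms(2) by (auto simp: mem_colon_iff elem_colon_def m_assoc)
    then have "x \<otimes>\<^bsub>B\<^esub> (y \<otimes>\<^bsub>B\<^esub> b) \<in> J" using x by (simp add: mem_colon_iff)
    moreover have "x \<otimes>\<^bsub>B\<^esub> (y \<otimes>\<^bsub>B\<^esub> b) = (b \<otimes>\<^bsub>B\<^esub> x) \<otimes>\<^bsub>B\<^esub> y"
      using xB yB assms(2) by (simp add: m_ac)
    ultimately show ?thesis by simp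
  qed
  then show "x \<in> elem_colon B (colon B J (colon B J I)) b"
    using xB assms(2) by (auto simp: mem_colon_iff elem_colon_def)
qed

lemma MultD:
  assumes "star \<in> Mult A B G"
  shows "star \<in> extensional G"
    and "I \<in> G \<Longrightarrow> star I \<in> G"
    and "I \<in> G \<Longrightarrow> I \<subseteq> star I"
    and "I \<in> G \<Longrightarrow> J \<in> G \<Longrightarrow> I \<subseteq> J \<Longrightarrow> star I \<subseteq> star J"
    and "I \<in> G \<Longrightarrow> star (star I) = star I"
    and "I \<in> G \<Longrightarrow> b \<in> carrier B \<Longrightarrow> elem_colon B I b \<in> G \<Longrightarrow>
           star (elem_colon B I b) \<subseteq> elem_colon B (star I) b"
  using assms by (auto simp: Mult_def closure_operation_on_def dest: mono_onD)

lemma MultI: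
  assumes "star \<in> extensional G"
    and "\<And>I. I \<in> G \<Longrightarrow> star I \<in> G"
    and "\<And>I. I \<in> G \<Longrightarrow> I \<subseteq> star I"
    and "\<And>I J. I \<in> G \<Longrightarrow> J \<in> G \<Longrightarrow> I \<subseteq> J \<Longrightarrow> star I \<subseteq> star J"
    and "\<And>I. I \<in> G \<Longrightarrow> star (star I) \<subseteq> star I"
    and "\<And>I b. I \<in> G \<Longrightarrow> b \<in> carrier B \<Longrightarrow> elem_colon B I b \<in> G \<Longrightarrow>
           star (elem_colon B I b) \<subseteq> elem_colon B (star I) b"
  shows "star \<in> Mult A B G"
proof -
  have "star (star I) = star I" if "I \<in> G" for I
    using that assms(2,3,5) by (meson subset_antisym)
  then show ?thesis
    using assms by (auto simp: Mult_def closure_operation_on_def mono_on_def)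
qed

text \<open>
  Idempotence holds because the members \<open>J\<close> of the intersection can be treated one at a time:
  the result for \<open>I\<close> lies in \<open>(J : (J : I))\<close>, and this is fixed by \<open>X \<mapsto> (J : (J : X))\<close>.
\<close>

lemma hat_op_in_Mult:
  assumes ext: "ring_extension A B" and G1: "G1 \<subseteq> submods A B" and up: "upward_closed A B G2"
  shows "hat_op B G1 G2 star \<in> Mult A B G2"
proof -
  have G2: "I \<subseteq> carrier B" if "I \<in> G2" for I
    using up that submods_subset by (auto simp: upward_closed_def)
  have le: "I \<subseteq> hat_op B G1 G2 star I" if "I \<in> G2" for I
    using that G2[OF that] subset_colon_colon[OF ext G2[OF that]] unfolding hat_op_def
    by (simp add: le_INF_iff)
  have closed: "hat_op B G1 G2 star I \<in> G2" if "I \<in> G2" for I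
  proof -
    have "hat_op B G1 G2 star I \<in> submods A B"
      using that G1 by (auto simp: hat_op_def
          intro!: carrier_Int_INT_in_submods colon_in_submods ext colon_subset_carrier)
    then show ?thesis
      using up le[OF that] that by (auto simp: upward_closed_def)
  qed
  show ?thesis
  proof (rule MultI)
    show "hat_op B G1 G2 star I \<subseteq> hat_op B G1 G2 star I'"
      if "I \<in> G2" "I' \<in> G2" "I \<subseteq> I'" for I I'
    proof -
      have "colon B J (colon B J I) \<subseteq> colon B J (colon B J I')" for J
        using that(3) by (intro colon_antimono)
      then show ?thesis using that unfolding hat_op_def by simp blast
    qed
    show "hat_op B G1 G2 star (hat_op B G1 G2 star I) \<subseteq> hat_op B G1 G2 star I"
      if "I \<in> G2" for I
    proof -
      have "colon B J (colon B J (hat_op B G1 G2 star I)) \<subseteq> colon B J (colon B J I)"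
        if J: "J \<in> G1" "J = star J" for J
      proof (rule colon_antimono)
        have "hat_op B G1 G2 star I \<subseteq> colon B J (colon B J I)"
          using \<open>I \<in> G2\<close> J by (auto simp: hat_op_def)
        then have "colon B J (colon B J (colon B J I)) \<subseteq> colon B J (hat_op B G1 G2 star I)"
          by (rule colon_antimono)
        then show "colon B J I \<subseteq> colon B J (hat_op B G1 G2 star I)"
          using subset_colon_colon[OF ext colon_subset_carrier] by blast
      qed
      then show ?thesis
        using closed[OF that] that unfolding hat_op_def by simp blast
    qed
    show "hat_op B G1 G2 star (elem_colon B I b) \<subseteq> elem_colon B (hat_op B G1 G2 star I) b"
      if I: "I \<in> G2" "b \<in> carrier B" "elem_colon B I b \<in> G2" for I b
    proof
      interpret cring B using ext by (simp add: ring_extension_def)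
      fix x assume x: "x \<in> hat_op B G1 G2 star (elem_colon B I b)"
      then have "x \<in> carrier B" using I by (simp add: hat_op_def)
      moreover have "b \<otimes>\<^bsub>B\<^esub> x \<in> colon B J (colon B J I)" if "J \<in> G1" "J = star J" for J
        using x I that colon_colon_multiplicative[OF ext I(2), of J I]
        by (auto simp: hat_op_def elem_colon_def)
      ultimately show "x \<in> elem_colon B (hat_op B G1 G2 star I) b"
        using I by (simp add: hat_op_def elem_colon_def)
    qed
  qed (use le closed in \<open>auto simp: hat_op_def\<close>)
qed

text \<open>
  A \<open>star2\<close>-closed \<open>J\<close> satisfies \<open>J \<subseteq> star1 J \<subseteq> star2 J = J\<close>, so it also occurs in the
  intersection for \<open>star1\<close>.
\<close>

lemma hat_op_mono:
  assumes s1: "star1 \<in> Mult A B G1" and le: "mult_le G1 star1 star2"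
  shows "mult_le G2 (hat_op B G1 G2 star1) (hat_op B G1 G2 star2)"
proof -
  have "J = star1 J" if "J \<in> G1" "J = star2 J" for J
    using that MultD(3)[OF s1 that(1)] le by (auto simp: mult_le_def)
  then show ?thesis by (fastforce simp: mult_le_def hat_op_def)
qed

text \<open>
  The submodule \<open>(J : b)\<close> inherits closedness from \<open>J\<close>, since \<open>(J : b)\<^sup>\<star> \<subseteq> (J\<^sup>\<star> : b) = (J : b)\<close>.
  Multiplicativity may be applied to it because it contains \<open>I\<close> and therefore lies in \<open>G\<close>.
\<close>

lemma closed_elem_colon:
  assumes "ring_extension A B" and "upward_closed A B G" and star: "star \<in> Mult A B G"
    and "I \<in> G" "J \<in> G" "J = star J" "b \<in> carrier B" "I \<subseteq> elem_colon B J b"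
  shows "star I \<subseteq> elem_colon B J b"
proof -
  have "elem_colon B J b \<in> G"
    using assms elem_colon_in_submods[OF assms(1)] by (auto simp: upward_closed_def)
  then show ?thesis
    using MultD(4)[OF star] MultD(6)[OF star] assms by (metis subset_trans)
qed

text \<open>
  One inclusion needs only the factor at \<open>J = star I\<close>, evaluated on \<open>1 \<in> (star I : I)\<close>; the
  other holds for each factor, by the previous lemma applied to every \<open>y \<in> (J : I)\<close>.
\<close>

lemma hat_op_eq:
  assumes ext: "ring_extension A B" and up: "upward_closed A B G1" and "G1 \<subseteq> G2"
    and star: "star \<in> Mult A B G1" and I: "I \<in> G1"
  shows "hat_op B G1 G2 star I = star I"
proof
  interpret cring B using ext by (simp add: ring_extension_def)
  have sub: "X \<subseteq> carrier B" if "X \<in> G1" for X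
    using up that submods_subset by (auto simp: upward_closed_def)
  have I2: "I \<in> G2" using I assms(3) by blast
  note sI = MultD(2)[OF star I]
  show "hat_op B G1 G2 star I \<subseteq> star I"
  proof
    fix x assume "x \<in> hat_op B G1 G2 star I"
    then have x: "x \<in> colon B (star I) (colon B (star I) I)" "x \<in> carrier B"
      using I2 sI MultD(5)[OF star I] by (auto simp: hat_op_def)
    have "\<one>\<^bsub>B\<^esub> \<in> colon B (star I) I"
      using MultD(3)[OF star I] sub[OF I] by (auto simp: mem_colon_iff subset_iff)
    then have "x \<otimes>\<^bsub>B\<^esub> \<one>\<^bsub>B\<^esub> \<in> star I"
      using x(1) unfolding mem_colon_iff[of x] by blast
    then show "x \<in> star I" using x by simp
  qed
  have "star I \<subseteq> colon B J (colon B J I)" if J: "J \<in> G1" "J = star J" for J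
  proof
    fix x assume x: "x \<in> star I"
    then have xB: "x \<in> carrier B" using sub[OF sI] by blast
    have "x \<otimes>\<^bsub>B\<^esub> y \<in> J" if y: "y \<in> colon B J I" for y
    proof -
      have yB: "y \<in> carrier B" using y by (simp add: mem_colon_iff)
      have "I \<subseteq> elem_colon B J y"
        using y sub[OF I] by (auto simp: mem_colon_iff elem_colon_def)
      then have "x \<in> elem_colon B J y"
        using closed_elem_colon[OF ext up star I J yB] x by blast
      then show ?thesis using xB yB by (simp add: elem_colon_def m_comm)
    qed
    then show "x \<in> colon B J (colon B J I)" using xB by (simp add: mem_colon_iff)
  qed
  then show "star I \<subseteq> hat_op B G1 G2 star I"
    using I2 sub[OF sI] by (auto simp: hat_op_def)
qed

text \<open>
  Extensivity and upward closedness keep \<open>\<star>\<close> inside the smaller family, and the axioms of a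
  multiplicative operation are universal statements about the members of the family.
\<close>

lemma restr_op_in_Mult:
  assumes up: "upward_closed A B G1" and "G2 \<subseteq> submods A B" and sub: "G1 \<subseteq> G2"
    and star: "star \<in> Mult A B G2"
  shows "restr_op G1 star \<in> Mult A B G1"
proof -
  have closed: "star I \<in> G1" if "I \<in> G1" for I
    using that MultD(2,3)[OF star, of I] assms(2) sub up
    unfolding upward_closed_def by blast
  show ?thesis
  proof (rule MultI)
    show "restr_op G1 star I \<subseteq> restr_op G1 star J" if "I \<in> G1" "J \<in> G1" "I \<subseteq> J" for I J
      using that MultD(4)[OF star, of I J] sub by (auto simp: restr_op_def)
    show "restr_op G1 star (elem_colon B I b) \<subseteq> elem_colon B (restr_op G1 star I) b"
      if "I \<in> G1" "b \<in> carrier B" "elem_colon B I b \<in> G1" for I b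
      using that MultD(6)[OF star, of I b] sub by (auto simp: restr_op_def)
  qed (use closed sub MultD(3)[OF star] MultD(5)[OF star] in \<open>auto simp: restr_op_def\<close>)
qed

theorem proposition4p6:
  fixes A :: "'a set" and B :: "('a, 'm) ring_scheme" and G1 G2 :: "'a set set"
  assumes "ring_extension A B"
    and "upward_closed A B G1" and "upward_closed A B G2" and "G1 \<subseteq> G2"
  shows "(\<forall>star \<in> Mult A B G1. hat_op B G1 G2 star \<in> Mult A B G2) \<and>
         (hat_op B G1 G2 \<in> Mult A B G1 \<rightarrow> Mult A B G2 \<and>
          monotone_on (Mult A B G1) (mult_le G1) (mult_le G2) (hat_op B G1 G2)) \<and>
         ((\<forall>star \<in> Mult A B G1. (restr_op G1 \<circ> hat_op B G1 G2) star = star) \<and>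
          inj_on (hat_op B G1 G2) (Mult A B G1) \<and>
          restr_op G1 ` Mult A B G2 = Mult A B G1)"
proof -
  have subs: "G1 \<subseteq> submods A B" "G2 \<subseteq> submods A B"
    using assms(2,3) by (auto simp: upward_closed_def)
  have hat: "hat_op B G1 G2 star \<in> Mult A B G2" for star
    using hat_op_in_Mult[OF assms(1) subs(1) assms(3)] .
  have mono: "monotone_on (Mult A B G1) (mult_le G1) (mult_le G2) (hat_op B G1 G2)"
    by (intro monotone_onI hat_op_mono)
  have inv: "restr_op G1 (hat_op B G1 G2 star) = star" if "star \<in> Mult A B G1" for star
    using hat_op_eq[OF assms(1,2,4) that] MultD(1)[OF that]
    by (intro extensionalityI[of _ G1]) (auto simp: restr_op_def)
  have "inj_on (hat_op B G1 G2) (Mult A B G1)"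
    by (rule inj_on_inverseI[of _ "restr_op G1"]) (rule inv)
  moreover have "restr_op G1 ` Mult A B G2 = Mult A B G1"
  proof
    show "restr_op G1 ` Mult A B G2 \<subseteq> Mult A B G1"
      using restr_op_in_Mult[OF assms(2) subs(2) assms(4)] by blast
    show "Mult A B G1 \<subseteq> restr_op G1 ` Mult A B G2"
      using inv hat by (metis image_eqI subsetI)
  qed
  ultimately show ?thesis using hat mono inv by auto
qed

end
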